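(* Let $N$ be a 3-prime left near-ring and let $d : N \to N$ be a multiplicative derivation of $N$ such that $d(xy) = d(y)d(x)$ for all $x,y \in N$. Then $d = 0$.
   Context: A (left) near-ring is a set $N$ with two binary operations $+$ and $\cdot$ such that $(N,+)$ is a group (not assumed abelian, written additively with identity $0$), multiplication is associative, and $x(y+z) = xy + xz$ for all $x,y,z \in N$ (right distributivity and a multiplicative identity are not assumed). $N$ is 3-prime if, for $x,y \in N$, $xNy = \{0\}$ (i.e. $xny = 0$ for all $n \in N$) implies $x = 0$ or $y = 0$. A multiplicative derivation of $N$ is a map $d : N \to N$, not assumed additive, with $d(xy) = x d(y) + d(x) y$ for all $x,y \in N$. *)

theory Defs
  imports Main
begin

text \<open>
  Only left distributivity is assumed, and the additive group need not be commutative.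
  In particular \<open>0 * x = 0\<close> is not available, and there need be no multiplicative identity.
\<close>

class left_near_ring = group_add + semigroup_mult +
  assumes near_ring_distrib_left: "x * (y + z) = x * y + x * z"

text \<open>The pointwise premise below is \<open>x N y = {0}\<close>, as \<open>N\<close> is never empty.\<close>

definition three_prime :: "'a::left_near_ring itself \<Rightarrow> bool" where
  "three_prime (_ :: 'a itself) \<longleftrightarrow>
     (\<forall>x y :: 'a. (\<forall>n. x * n * y = 0) \<longrightarrow> x = 0 \<or> y = 0)"

definition multiplicative_derivation :: "('a::left_near_ring \<Rightarrow> 'a) \<Rightarrow> bool" where
  "multiplicative_derivation d \<longleftrightarrow> (\<forall>x y. d (x * y) = x * d y + d x * y)"

end

theory Submission
  imports Defs
begin

text \<open>
  Constants \<open>0 * x\<close> are first ruled out by evaluating \<open>d\<close> on them, so \<open>N\<close> is zero-symmetric.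
  Computing \<open>d (x * (x * y))\<close> in two ways gives \<open>d x * x * y = d x * y * d x\<close>; replacing \<open>y\<close> by
  \<open>y * r\<close> and using 3-primeness makes every \<open>d x\<close> central. A nonzero central element can be
  cancelled on the left, so \<open>d x \<noteq> 0\<close> forces \<open>x * y = d x * y\<close> for all \<open>y\<close>, and then
  \<open>d y * d x = x * d y + d x * y\<close> collapses to \<open>d x * y = 0\<close>.
\<close>

lemma near_ring_mult_zero_right: "x * 0 = (0::'a::left_near_ring)"
  using near_ring_distrib_left[of x 0 0] by (metis add_0_right add_left_cancel)

lemma near_ring_mult_minus_right: "x * (- y) = - (x * y)" for x y :: "'a::left_near_ring"
  using near_ring_distrib_left[of x y "- y"]
  by (simp add: near_ring_mult_zero_right minus_unique)

lemma near_ring_mult_diff_right: "x * (y - z) = x * y - x * z" for x y z :: "'a::left_near_ring"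
  using near_ring_distrib_left[of x y "- z"] by (simp add: near_ring_mult_minus_right)

lemma three_primeD:
  fixes x y :: "'a::left_near_ring"
  assumes "three_prime TYPE('a)" and "\<And>n. x * n * y = 0"
  shows "x = 0 \<or> y = 0"
  using assms unfolding three_prime_def by blast

text \<open>Centrality turns \<open>z * n * (a - b)\<close> into
  \<open>n * (z * (a - b)) = 0\<close>, so 3-primeness applies.\<close>

lemma three_prime_central_cancel:
  fixes z a b :: "'a::left_near_ring"
  assumes "three_prime TYPE('a)" and central: "\<And>r. z * r = r * z"
    and "z \<noteq> 0" and "z * a = z * b"
  shows "a = b"
proof -
  have "z * (a - b) = 0"
    using assms(4) by (simp add: near_ring_mult_diff_right)
  then have "z * n * (a - b) = 0" for n
    by (simp add: central[of n] mult.assoc near_ring_mult_zero_right)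
  then show ?thesis
    using three_primeD[OF assms(1), of z "a - b"] assms(3) by simp
qed

lemma multiplicative_derivation_mult:
  "multiplicative_derivation d \<Longrightarrow> d (x * y) = x * d y + d x * y"
  unfolding multiplicative_derivation_def by blast

text \<open>Right distributivity does hold for the particular sum \<open>x * d y + d x * y\<close>, because
  \<open>d (x * y * z)\<close> can be expanded along either bracketing.\<close>

lemma multiplicative_derivation_partial_distrib:
  fixes d :: "'a::left_near_ring \<Rightarrow> 'a"
  assumes "multiplicative_derivation d"
  shows "d (x * y) * z = x * d y * z + d x * y * z"
proof -
  note D = multiplicative_derivation_mult[OF assms]
  have "x * y * d z + d (x * y) * z = d (x * (y * z))"
    by (simp add: D[of "x * y" z] flip: mult.assoc)
  also have "\<dots> = x * y * d z + (x * d y * z + d x * y * z)"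
    by (simp only: D[of x "y * z"] D[of y z] near_ring_distrib_left mult.assoc add.assoc)
  finally show ?thesis
    by simp
qed

text \<open>\<open>d 0\<close> absorbs every left factor. Hence \<open>d (d 0) = d 0\<close> once
  \<open>0 * d (d 0)\<close> vanishes, and then
  \<open>d 0 = 0 * d 0 = 0 * d (d 0) = 0\<close>.\<close>

lemma anti_multiplicative_derivation_zero:
  fixes d :: "'a::left_near_ring \<Rightarrow> 'a"
  assumes "multiplicative_derivation d" and anti: "\<And>x y. d (x * y) = d y * d x"
  shows "d 0 = 0"
proof -
  note D = multiplicative_derivation_mult[OF assms(1)]
  have fixed: "x * d 0 = d 0" for x
    using D[of x 0] by (simp add: near_ring_mult_zero_right)
  have vanish: "0 * d x + d 0 * x = d 0" for x
    using D[of 0 x] anti[of 0 x] by (simp add: fixed)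
  \<comment> \<open>In \<open>vanish\<close> at \<open>d 0\<close> the second summand is
    \<open>d 0 * d 0 = d 0\<close>, which cancels.\<close>
  have "0 * d (d 0) = 0"
    using vanish[of "d 0"] by (metis fixed add_0_left add_right_cancel)
  moreover have "d (d 0) = 0 * d (d 0) + d 0"
    using D[of 0 "d 0"] by (simp add: fixed)
  ultimately show ?thesis
    by (simp add: fixed)
qed

lemma anti_multiplicative_derivation_zero_symmetric:
  fixes d :: "'a::left_near_ring \<Rightarrow> 'a"
  assumes "multiplicative_derivation d" and anti: "\<And>x y. d (x * y) = d y * d x"
  shows "0 * x = (0::'a)"
proof -
  note D = multiplicative_derivation_mult[OF assms(1)]
  have idem: "0 * (0 * x) = 0 * x"
    by (simp add: near_ring_mult_zero_right flip: mult.assoc)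
  have "d (0 * x) = 0"
    using anti[of 0 x] anti_multiplicative_derivation_zero[OF assms]
    by (simp add: near_ring_mult_zero_right)
  then show ?thesis
    \<comment> \<open>As \<open>0 * x\<close> is fixed by left multiplication by \<open>0\<close>,
      the product rule leaves \<open>0 * x\<close> as the value of \<open>d (0 * x)\<close>.\<close>
    using D[of 0 "0 * x"] anti_multiplicative_derivation_zero[OF assms]
    by (simp add: idem near_ring_mult_zero_right)
qed

lemma anti_multiplicative_derivation_swap:
  fixes d :: "'a::left_near_ring \<Rightarrow> 'a"
  assumes "multiplicative_derivation d" and anti: "\<And>x y. d (x * y) = d y * d x"
  shows "d x * x * y = d x * y * d x"
proof -
  have "x * d y * d x + d x * x * y = d (x * (x * y))"
    by (simp add: multiplicative_derivation_mult[OF assms(1), of x "x * y"] anti[of x y] mult.assoc)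
  \<comment> \<open>Here \<open>d (x * y) * d x\<close> splits by the partial right distributivity;
    the common left summand then cancels.\<close>
  also have "\<dots> = x * d y * d x + d x * y * d x"
    by (simp only: anti[of x "x * y"] multiplicative_derivation_partial_distrib[OF assms(1)])
  finally show ?thesis
    by simp
qed

lemma anti_multiplicative_derivation_central:
  fixes d :: "'a::left_near_ring \<Rightarrow> 'a"
  assumes "three_prime TYPE('a)" and "multiplicative_derivation d"
    and anti: "\<And>x y. d (x * y) = d y * d x"
  shows "d x * r = r * d x"
proof -
  note swap = anti_multiplicative_derivation_swap[OF assms(2) anti]
  \<comment> \<open>Both sides equal \<open>d x * x * y * r\<close>.\<close>
  have "d x * y * (r * d x) = d x * y * (d x * r)" for y
    using swap[of x "y * r"] swap[of x y] by (metis mult.assoc)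
  then have "d x * y * (r * d x - d x * r) = 0" for y
    by (simp add: near_ring_mult_diff_right)
  then have "d x = 0 \<or> r * d x = d x * r"
    using three_primeD[OF assms(1), of "d x" "r * d x - d x * r"] by simp
  \<comment> \<open>If \<open>d x = 0\<close>, the claim reads \<open>0 * r = r * 0\<close>, which
    needs zero-symmetry.\<close>
  then show ?thesis
    using anti_multiplicative_derivation_zero_symmetric[OF assms(2) anti]
    by (auto simp: near_ring_mult_zero_right)
qed

theorem theorem3:
  fixes d :: "'a::left_near_ring \<Rightarrow> 'a"
  assumes "three_prime TYPE('a)"
    and "multiplicative_derivation d"
    and "\<And>x y. d (x * y) = d y * d x"
  shows "d = (\<lambda>x. 0)"
proof
  fix x
  note central = anti_multiplicative_derivation_central[OF assms]
  show "d x = 0"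
  proof (rule ccontr)
    assume nz: "d x \<noteq> 0"
    have "d x * (x * y) = d x * (d x * y)" for y
      using anti_multiplicative_derivation_swap[OF assms(2,3), of x y] central[of x y]
      by (metis mult.assoc)
    then have mult_eq: "x * y = d x * y" for y
      using three_prime_central_cancel[OF assms(1) central nz] by blast
    \<comment> \<open>By \<open>mult_eq\<close> and centrality,
      \<open>x * d y = d x * d y = d y * d x\<close>, which cancels against
      \<open>d (x * y)\<close>.\<close>
    have "d x * y = 0" for y
      using multiplicative_derivation_mult[OF assms(2), of x y] assms(3)[of x y]
        mult_eq[of "d y"] central[of x "d y"] by (metis add_0_right add_left_cancel)
    then have "d x * n * d x = 0" for n
      by (metis mult.assoc)
    then show False
      using three_primeD[OF assms(1), of "d x" "d x"] nz by simp
  qed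
qed

end
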